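(* Let $\mathcal{X},\mathcal{Y}$ be real Hilbert spaces, $f:\mathcal{X}\to\mathbb{R}$ a continuously differentiable convex function such that $\nabla f$ is Lipschitz continuous, $A:\mathcal{X}\to\mathcal{Y}$ a continuous linear operator, $b\in\mathcal{Y}$, $\theta>0$, $t_0>0$, $\sigma\ge0$. Let $\gamma,\beta,\epsilon:[t_0,+\infty)\to[0,+\infty)$ be $\mathcal{C}^1$ functions such that $\epsilon$ is non-increasing, $\int_{t_0}^{+\infty}\frac{\beta(t)\epsilon(t)}{t}\,dt<+\infty$, and for all $t\ge t_0$ $$(2\theta-1)\beta(t)+\theta t\dot\beta(t)\le 0,\qquad \gamma(t)+t\dot\gamma(t)\le t\beta(t)\epsilon(t),\qquad \theta t\gamma(t)-\theta-1\ge 0.$$ Let $(x(t),\lambda(t))_{t\ge t_0}$ be any trajectory (global solution) of $$\begin{cases}\ddot x(t)+\gamma(t)\dot x(t)+\beta(t)\big(\nabla f(x(t))+A^T\lambda(t)+\sigma A^T(Ax(t)-b)+\epsilon(t)x(t)\big)=0,\\ \dot\lambda(t)-t\beta(t)\big(A(x(t)+\theta t\dot x(t))-b\big)=0,\end{cases}\qquad t\ge t_0,$$ and let $(x^*,\lambda^* )\in\Omega$. Then: (a) $\lim_{t\to+\infty}\big\|\frac{1}{\theta t}(x(t)-x^* )+\dot x(t)\big\|=0$. (b) If $\liminf_{t\to+\infty}\beta(t)\ne0$, then $\lim_{t\to+\infty}\big(\mathcal{L}_\sigma(x(t),\lambda^* )-\mathcal{L}_\sigma(x^*,\lambda^* )\big)=0$.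 In particular, if $\lim_{t\to+\infty}\beta(t)=+\infty$, then, as $t\to+\infty$, $\mathcal{L}_\sigma(x(t),\lambda^* )-\mathcal{L}_\sigma(x^*,\lambda^* )=o(\frac{1}{\beta(t)})$ and $\|\nabla f(x(t))-\nabla f(x^* )\|=o(\frac{1}{\sqrt{\beta(t)}})$.
   Context: The underlying optimization problem is $\min_{x\in\mathcal{X}} f(x)$ subject to $Ax=b$. $A^T:\mathcal{Y}\to\mathcal{X}$ denotes the adjoint of $A$. The augmented Lagrangian is $\mathcal{L}_\sigma(x,\lambda)=f(x)+\langle\lambda,Ax-b\rangle+\frac{\sigma}{2}\|Ax-b\|^2$ on $\mathcal{X}\times\mathcal{Y}$, with penalty parameter $\sigma\ge0$. $\Omega$ is the set of saddle points (primal-dual optimal solutions): $(x^*,\lambda^* )\in\Omega$ iff $\mathcal{L}_\sigma(x^*,\lambda)\le\mathcal{L}_\sigma(x^*,\lambda^* )\le\mathcal{L}_\sigma(x,\lambda^* )$ for all $(x,\lambda)\in\mathcal{X}\times\mathcal{Y}$; $\Omega$ is assumed nonempty. A trajectory (global solution) is a pair $x:[t_0,+\infty)\to\mathcal{X}$ (twice differentiable), $\lambda:[t_0,+\infty)\to\mathcal{Y}$ (differentiable) satisfying the system for all $t\ge t_0$. Dots denote derivatives in $t$. *)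

theory Defs
  imports "HOL-Analysis.Analysis" "HOL-Library.Landau_Symbols"
begin

text \<open>A real Hilbert space is a type of sort \<open>{real_inner, complete_space}\<close>.\<close>

definition aug_lagrangian ::
  "('a::real_inner \<Rightarrow> real) \<Rightarrow> ('a \<Rightarrow> 'b::real_inner) \<Rightarrow> 'b \<Rightarrow> real \<Rightarrow> 'a \<Rightarrow> 'b \<Rightarrow> real"
  where "aug_lagrangian f A b \<sigma> x lam =
    f x + lam \<bullet> (A x - b) + \<sigma> / 2 * (norm (A x - b))\<^sup>2"

definition saddle_points ::
  "('a::real_inner \<Rightarrow> real) \<Rightarrow> ('a \<Rightarrow> 'b::real_inner) \<Rightarrow> 'b \<Rightarrow> real \<Rightarrow> ('a \<times> 'b) set"
  where "saddle_points f A b \<sigma> = {(xs, ls). \<forall>x lam.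
    aug_lagrangian f A b \<sigma> xs lam \<le> aug_lagrangian f A b \<sigma> xs ls \<and>
    aug_lagrangian f A b \<sigma> xs ls \<le> aug_lagrangian f A b \<sigma> x ls}"

text \<open>\<open>C\<^sup>1\<close> on a set, with derivative \<open>g'\<close>. The derivative is taken within \<open>S\<close>, so that for
  \<open>S = {t0..}\<close> it is the right derivative at \<open>t0\<close> and values of \<open>g\<close> outside \<open>S\<close> are irrelevant.\<close>

definition C1_on_with :: "real set \<Rightarrow> (real \<Rightarrow> real) \<Rightarrow> (real \<Rightarrow> real) \<Rightarrow> bool"
  where "C1_on_with S g g' \<longleftrightarrow>
    (\<forall>t\<in>S. (g has_real_derivative g' t) (at t within S)) \<and> continuous_on S g'"

text \<open>\<open>gradf\<close> is the gradient of the objective; \<open>x'\<close>, \<open>x''\<close> and \<open>lam'\<close> are the (uniquely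
  determined) time derivatives of \<open>x\<close> and \<open>lam\<close> on \<open>{t0..}\<close>. The transpose \<open>A\<^sup>T\<close> is the
  library's \<open>adjoint A\<close>, which is a choice operator: that it satisfies
  \<open>A x \<bullet> y = x \<bullet> adjoint A y\<close> relies on \<open>A\<close> being bounded and on completeness.\<close>

definition trajectory ::
  "('a::real_inner \<Rightarrow> 'a) \<Rightarrow> ('a \<Rightarrow> 'b::real_inner) \<Rightarrow> 'b \<Rightarrow> real \<Rightarrow> real \<Rightarrow> real \<Rightarrow>
   (real \<Rightarrow> real) \<Rightarrow> (real \<Rightarrow> real) \<Rightarrow> (real \<Rightarrow> real) \<Rightarrow>
   (real \<Rightarrow> 'a) \<Rightarrow> (real \<Rightarrow> 'a) \<Rightarrow> (real \<Rightarrow> 'a) \<Rightarrow> (real \<Rightarrow> 'b) \<Rightarrow> (real \<Rightarrow> 'b) \<Rightarrow> bool"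
  where "trajectory gradf A b \<theta> t0 \<sigma> \<gamma> \<beta> \<epsilon> x x' x'' lam lam' \<longleftrightarrow>
    (\<forall>t\<ge>t0.
      (x has_vector_derivative x' t) (at t within {t0..}) \<and>
      (x' has_vector_derivative x'' t) (at t within {t0..}) \<and>
      (lam has_vector_derivative lam' t) (at t within {t0..}) \<and>
      x'' t + \<gamma> t *\<^sub>R x' t
        + \<beta> t *\<^sub>R (gradf (x t) + adjoint A (lam t)
                  + \<sigma> *\<^sub>R adjoint A (A (x t) - b) + \<epsilon> t *\<^sub>R x t) = 0 \<and>
      lam' t - (t * \<beta> t) *\<^sub>R (A (x t + (\<theta> * t) *\<^sub>R x' t) - b) = 0)"

end

theory Submission
  imports Defs
begin

text \<open>With \<open>v t = (1/\<theta>)(x t - xs) + t x' t\<close> and \<open>gap\<close> the Lagrangian gap at \<open>x t\<close>, the energy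
  \<open>E = t\<^sup>2 \<beta> (gap + \<epsilon>/2 |x|\<^sup>2) + |v|\<^sup>2/2 + (\<theta> t \<gamma> - \<theta> - 1)/(2\<theta>\<^sup>2) |x - xs|\<^sup>2 + |lam - ls|\<^sup>2/(2\<theta>)\<close>
  satisfies \<open>E' \<le> C t\<^sup>2 h\<close> with \<open>h = \<beta> \<epsilon> / t\<close> integrable. Integrating from a large \<open>T\<close> gives
  \<open>E t \<le> E T + C t\<^sup>2 \<integral>\<^sub>T h\<close>, hence \<open>E = o(t\<^sup>2)\<close>; all terms of \<open>E\<close> being nonnegative, both
  \<open>|v| / t\<close> and \<open>\<beta> gap\<close> tend to 0. The gradient rate follows from
  \<open>|gradf x - gradf xs|\<^sup>2 \<le> 2 L gap\<close>, valid for convex functions with \<open>L\<close>-Lipschitz gradient.\<close>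

section \<open>Riesz representation and the adjoint in Hilbert spaces\<close>

text \<open>The representing vector minimises \<open>|x|\<^sup>2/2 - \<phi> x\<close>; the parallelogram identity makes minimising
  sequences Cauchy.\<close>

lemma riesz_representation:
  fixes \<phi> :: "'a::{real_inner, complete_space} \<Rightarrow> real"
  assumes \<phi>: "bounded_linear \<phi>"
  obtains z where "\<And>h. \<phi> h = z \<bullet> h"
proof -
  interpret \<phi>: bounded_linear \<phi> by (rule \<phi>)
  define q where "q = (\<lambda>x. x \<bullet> x / 2 - \<phi> x)"
  define m where "m = (INF x. q x)"
  obtain K where K: "\<And>x. norm (\<phi> x) \<le> norm x * K"
    using \<phi>.bounded by blast
  \<comment> \<open>Boundedness of \<open>\<phi>\<close> leaves a quadratic in
    \<open>norm x\<close>; completing the square bounds it below, so the infimum \<open>m\<close> is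
    finite.\<close>
  have "q x \<ge> - K\<^sup>2 / 2" for x
  proof -
    have "q x \<ge> (norm x)\<^sup>2 / 2 - norm x * K"
      using K[of x] by (auto simp: q_def power2_norm_eq_inner)
    moreover have "(norm x - K)\<^sup>2 \<ge> 0" by simp
    ultimately show ?thesis by (simp add: power2_diff)
  qed
  then have bdd: "bdd_below (range q)" by (rule bdd_belowI2)
  have m_le: "m \<le> q x" for x
    unfolding m_def by (intro cINF_lower bdd) auto
  have close: "(norm (x - y))\<^sup>2 \<le> 4 * (q x - m + (q y - m))" for x y
  proof -
    \<comment> \<open>The linear part cancels against the midpoint, leaving only the parallelogram
      term; at the midpoint \<open>q\<close> is at least \<open>m\<close>.\<close>
    have "q x + q y - 2 * q ((1/2) *\<^sub>R (x + y)) = (norm (x - y))\<^sup>2 / 4"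
      by (simp add: q_def power2_norm_eq_inner \<phi>.add \<phi>.scaleR algebra_simps inner_commute)
    with m_le[of "(1/2) *\<^sub>R (x + y)"] show ?thesis by argo
  qed
  have "\<exists>x. q x < m + inverse (real (Suc n))" for n
    using cINF_less_iff[of UNIV q "m + inverse (real (Suc n))"] bdd unfolding m_def by auto
  then obtain X where X: "\<And>n. q (X n) < m + inverse (real (Suc n))" by metis
  have "Cauchy X"
  proof (rule metric_CauchyI)
    fix e :: real assume "0 < e"
    \<comment> \<open>\<open>close\<close> adds two excesses over \<open>m\<close> and multiplies by
      4, so an excess below \<open>e\<^sup>2 / 8\<close> for each point suffices.\<close>
    then obtain N where N: "inverse (real (Suc N)) < e\<^sup>2 / 8"
      using reals_Archimedean[of "e\<^sup>2 / 8"] by auto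
    have small: "q (X k) - m < e\<^sup>2 / 8" if "k \<ge> N" for k
    proof -
      have "inverse (real (Suc k)) \<le> inverse (real (Suc N))"
        using that by (intro le_imp_inverse_le) auto
      with X[of k] N show ?thesis by linarith
    qed
    have "dist (X i) (X j) < e" if "i \<ge> N" "j \<ge> N" for i j
    proof -
      have "(norm (X i - X j))\<^sup>2 < e\<^sup>2"
        using close[of "X i" "X j"] small[OF that(1)] small[OF that(2)] by argo
      then show ?thesis using \<open>0 < e\<close> by (simp add: dist_norm power2_less_imp_less)
    qed
    then show "\<exists>M. \<forall>i\<ge>M. \<forall>j\<ge>M. dist (X i) (X j) < e" by blast
  qed
  then obtain z where z: "X \<longlonglongrightarrow> z"
    using Cauchy_convergent convergent_def by blast
  have "(\<lambda>n. q (X n)) \<longlonglongrightarrow> q z"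
    unfolding q_def by (intro tendsto_intros z \<phi>.tendsto) simp
  moreover have "(\<lambda>n. m + inverse (real (Suc n))) \<longlonglongrightarrow> m"
    using tendsto_add[OF tendsto_const LIMSEQ_inverse_real_of_nat] by fastforce
  ultimately have "q z \<le> m"
    by (rule LIMSEQ_le) (use X in \<open>auto intro: less_imp_le\<close>)
  with m_le have min: "q z \<le> q x" for x by (meson order_trans)
  \<comment> \<open>The first-order condition at the minimiser \<open>z\<close> is exactly the
    representation.\<close>
  have "(q has_derivative (\<lambda>h. z \<bullet> h - \<phi> h)) (at z)"
    unfolding q_def
    by (auto intro!: derivative_eq_intros \<phi>.has_derivative simp: inner_commute)
  then have "(\<lambda>h. z \<bullet> h - \<phi> h) = (\<lambda>h. 0)"
    using min by (intro has_derivative_local_min[of q _ z]) auto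
  then have "\<phi> h = z \<bullet> h" for h by (metis eq_iff_diff_eq_0)
  then show thesis by (rule that)
qed

text \<open>The library's \<^const>\<open>adjoint\<close> is only known to work on Euclidean spaces.\<close>

lemma adjoint_works_Hilbert:
  fixes A :: "'a::{real_inner, complete_space} \<Rightarrow> 'b::real_inner"
  assumes "bounded_linear A"
  shows "x \<bullet> adjoint A y = A x \<bullet> y"
proof -
  \<comment> \<open>Riesz for each fixed \<open>y\<close> supplies the values of some adjoint map;
    uniqueness of adjoints then identifies \<open>adjoint A\<close> with it.\<close>
  have "\<exists>z. \<forall>x. A x \<bullet> y = x \<bullet> z" for y
  proof -
    have "bounded_linear (\<lambda>x. A x \<bullet> y)"
      using bounded_linear_compose[OF bounded_linear_inner_left assms] by simp
    then obtain z where "\<And>h. A h \<bullet> y = z \<bullet> h" by (rule riesz_representation) blast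
    then show ?thesis by (metis inner_commute)
  qed
  then obtain g where "\<forall>x y. A x \<bullet> y = x \<bullet> g y" by metis
  then show ?thesis using adjoint_unique[of A g] by simp
qed

section \<open>Convex functions with Lipschitz gradient\<close>

lemma GDERIV_compose_has_vector_derivative:
  assumes "GDERIV f (c t) :> G" and "(c has_vector_derivative c') (at t within S)"
  shows "((\<lambda>s. f (c s)) has_real_derivative c' \<bullet> G) (at t within S)"
  using has_derivative_compose[OF assms(2)[unfolded has_vector_derivative_def]
      assms(1)[unfolded gderiv_def]]
  by (simp add: has_field_derivative_def mult_commute_abs)

lemma GDERIV_along_line:
  assumes "\<And>z. GDERIV f z :> G z"
  shows "((\<lambda>s. f (x + s *\<^sub>R d)) has_real_derivative d \<bullet> G (x + s *\<^sub>R d)) (at s)"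
  by (intro GDERIV_compose_has_vector_derivative assms)
    (auto intro!: derivative_eq_intros)

text \<open>Along the line through \<open>x\<close> and \<open>y\<close> this is the tangent
  inequality in one real variable, based at parameter 0 and evaluated at 1.\<close>

lemma convex_on_above_tangent_GDERIV:
  assumes f: "convex_on UNIV f" and G: "\<And>z. GDERIV f z :> G z"
  shows "f y \<ge> f x + (y - x) \<bullet> G x"
proof -
  have "convex_on UNIV (\<lambda>s. f (x + s *\<^sub>R (y - x)))"
  proof (rule convex_onI)
    fix t :: real and r s :: real
    assume "0 < t" "t < 1"
    have "x + ((1 - t) *\<^sub>R r + t *\<^sub>R s) *\<^sub>R (y - x)
      = (1 - t) *\<^sub>R (x + r *\<^sub>R (y - x)) + t *\<^sub>R (x + s *\<^sub>R (y - x))"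
      by (simp add: algebra_simps)
    then show "f (x + ((1 - t) *\<^sub>R r + t *\<^sub>R s) *\<^sub>R (y - x))
      \<le> (1 - t) * f (x + r *\<^sub>R (y - x)) + t * f (x + s *\<^sub>R (y - x))"
      using convex_onD[OF f, of t] \<open>0 < t\<close> \<open>t < 1\<close> by simp
  qed simp
  from convex_on_imp_above_tangent[OF this, where c = 0 and f' = "(y - x) \<bullet> G x" and x = 1]
  show ?thesis using GDERIV_along_line[OF G, of x "y - x" 0] by simp
qed

text \<open>Along the segment, \<open>f\<close> minus its quadratic model is nonincreasing:
  Cauchy-Schwarz and the Lipschitz bound make its derivative nonpositive.\<close>

lemma descent_lemma:
  assumes G: "\<And>z. GDERIV f z :> G z" and lip: "L-lipschitz_on UNIV G"
  shows "f (x + d) \<le> f x + d \<bullet> G x + L / 2 * (norm d)\<^sup>2"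
proof -
  define \<phi> where "\<phi> s = f (x + s *\<^sub>R d) - s * (d \<bullet> G x) - L / 2 * s\<^sup>2 * (norm d)\<^sup>2" for s
  have "\<phi> 0 \<ge> \<phi> 1"
  proof (rule DERIV_nonpos_imp_nonincreasing[of 0 1 \<phi>])
    fix s :: real assume s: "0 \<le> s" "s \<le> 1"
    have "(\<phi> has_real_derivative
        d \<bullet> G (x + s *\<^sub>R d) - d \<bullet> G x - L * s * (norm d)\<^sup>2) (at s)"
      unfolding \<phi>_def by (auto intro!: derivative_eq_intros GDERIV_along_line G)
    moreover have "d \<bullet> (G (x + s *\<^sub>R d) - G x) \<le> norm d * (L * (s * norm d))"
      using lipschitz_onD[OF lip, of "x + s *\<^sub>R d" x] s
      by (intro order_trans[OF norm_cauchy_schwarz] mult_left_mono) (auto simp: dist_norm)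
    ultimately show "\<exists>y. (\<phi> has_real_derivative y) (at s) \<and> y \<le> 0"
      by (intro exI conjI) (auto simp: inner_diff_right power2_eq_square algebra_simps)
  qed simp
  then show ?thesis by (simp add: \<phi>_def)
qed

text \<open>A single point \<open>z\<close> is bounded below by the tangent at \<open>x\<close> and
  above by the descent lemma at \<open>y\<close>; comparing the two bounds gives the claim.\<close>

lemma convex_Lipschitz_gradient_bound:
  assumes f: "convex_on UNIV f" and G: "\<And>z. GDERIV f z :> G z"
    and lip: "L-lipschitz_on UNIV G" and "L > 0"
  shows "(norm (G y - G x))\<^sup>2 \<le> 2 * L * (f y - f x - (y - x) \<bullet> G x)"
proof -
  define w where "w = G y - G x"
  \<comment> \<open>A gradient step of size \<open>1 / L\<close> from \<open>y\<close> for
    \<open>f\<close> minus the linear function with gradient \<open>G x\<close>; it minimises the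
    upper bound from the descent lemma for that function.\<close>
  define z where "z = y + (- (1 / L)) *\<^sub>R w"
  have "f z \<ge> f x + (z - x) \<bullet> G x"
    by (rule convex_on_above_tangent_GDERIV[OF f G])
  moreover have "f z \<le> f y - (1 / L) * (w \<bullet> G y) + L / 2 * (norm ((1 / L) *\<^sub>R w))\<^sup>2"
    using descent_lemma[OF G lip, of y "(- (1 / L)) *\<^sub>R w"] unfolding z_def by simp
  moreover have "L / 2 * (norm ((1 / L) *\<^sub>R w))\<^sup>2 = (w \<bullet> w) / (2 * L)"
    using \<open>L > 0\<close> by (simp add: power_mult_distrib dot_square_norm power2_eq_square field_simps)
  moreover have "w \<bullet> G y = w \<bullet> w + w \<bullet> G x"
    by (simp add: w_def inner_diff_right)
  moreover have "(z - x) \<bullet> G x = (y - x) \<bullet> G x - (1 / L) * (w \<bullet> G x)"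
    by (simp add: z_def inner_diff_left inner_add_left)
  ultimately have "f x + ((y - x) \<bullet> G x - (1 / L) * (w \<bullet> G x))
      \<le> f y - (1 / L) * (w \<bullet> w + w \<bullet> G x) + w \<bullet> w / (2 * L)"
    by simp
  then have "w \<bullet> w / (2 * L) \<le> f y - f x - (y - x) \<bullet> G x"
    by (simp add: add_divide_distrib)
  then show ?thesis
    using \<open>L > 0\<close> by (simp add: w_def power2_norm_eq_inner field_simps)
qed

section \<open>Differentiation in time and growth estimates\<close>

lemma has_real_derivative_inner:
  assumes "(g has_vector_derivative g') (at t within S)"
    and "(h has_vector_derivative h') (at t within S)"
  shows "((\<lambda>t. g t \<bullet> h t) has_real_derivative (g t \<bullet> h' + g' \<bullet> h t)) (at t within S)"
proof -
  have "((\<lambda>t. g t \<bullet> h t) has_derivative (\<lambda>s. g t \<bullet> (s *\<^sub>R h') + (s *\<^sub>R g') \<bullet> h t)) (at t within S)"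
    using assms unfolding has_vector_derivative_def by (rule has_derivative_inner)
  then show ?thesis
    unfolding has_field_derivative_def
    by (rule has_derivative_eq_rhs) (auto simp: fun_eq_iff algebra_simps)
qed

text \<open>Integrating from \<open>T\<close> costs at most \<open>C * t\<^sup>2\<close> times the
  integral of \<open>h\<close> beyond \<open>T\<close>. After division by \<open>t\<^sup>2\<close>
  that part is small for large \<open>T\<close>, and the fixed value \<open>E T\<close> is washed
  out.\<close>

lemma tendsto_div_square_of_deriv_le:
  fixes E E' h :: "real \<Rightarrow> real"
  assumes "t0 > 0" and "C \<ge> 0"
    and dE: "\<And>t. t \<ge> t0 \<Longrightarrow> (E has_real_derivative E' t) (at t within {t0..})"
    and E': "\<And>t. t \<ge> t0 \<Longrightarrow> E' t \<le> C * t\<^sup>2 * h t"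
    and E0: "\<And>t. t \<ge> t0 \<Longrightarrow> E t \<ge> 0"
    and h0: "\<And>t. t \<ge> t0 \<Longrightarrow> h t \<ge> 0"
    and h: "continuous_on {t0..} h" "h integrable_on {t0..}"
  shows "((\<lambda>t. E t / t\<^sup>2) \<longlongrightarrow> 0) at_top"
proof -
  define F where "F t = integral {t0..t} h" for t
  have int: "h integrable_on {t0..t}" for t
    by (intro integrable_continuous_real continuous_on_subset[OF h(1)]) auto
  have F_mono: "F s \<le> F t" if "s \<le> t" for s t
    unfolding F_def using that h0 by (intro integral_subset_le int) auto
  have F_le: "F t \<le> integral {t0..} h" for t
    unfolding F_def using h0 by (intro integral_subset_le int h) auto
  have dF: "(F has_real_derivative h s) (at s within {t0..t})" if "s \<in> {t0..t}" for s t
    unfolding F_def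
    by (intro integral_has_real_derivative that continuous_on_subset[OF h(1)]) auto
  have growth: "E t \<le> E T + C * t\<^sup>2 * (F t - F T)" if T: "t0 \<le> T" "T \<le> t" for T t
  proof -
    \<comment> \<open>The weight is frozen at the right end \<open>t\<close>: since
      \<open>s\<^sup>2 \<le> t\<^sup>2\<close> and \<open>h\<close> is nonnegative, \<open>g\<close>
      decreases on the interval from \<open>T\<close> to \<open>t\<close>.\<close>
    define g where "g s = E s - C * t\<^sup>2 * F s" for s
    have dg: "(g has_real_derivative E' s - C * t\<^sup>2 * h s) (at s within {t0..t})"
      if "s \<in> {t0..t}" for s
      unfolding g_def using that
      by (intro DERIV_diff DERIV_cmult dF has_field_derivative_subset[OF dE]) auto
    have "g T \<ge> g t"
    \<comment> \<open>Two-sided derivatives are available only in the interior, as \<open>T\<close>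
      may equal \<open>t0\<close>; continuity covers the endpoints.\<close>
    proof (rule DERIV_nonpos_imp_decreasing_open[OF \<open>T \<le> t\<close>])
      fix s assume s: "T < s" "s < t"
      have "E' s \<le> C * s\<^sup>2 * h s" using s T by (intro E') auto
      also have "\<dots> \<le> C * t\<^sup>2 * h s"
        using s T \<open>t0 > 0\<close> \<open>C \<ge> 0\<close> h0[of s]
        by (intro mult_right_mono mult_left_mono power_mono) auto
      finally have "E' s - C * t\<^sup>2 * h s \<le> 0" by simp
      moreover have "(g has_real_derivative E' s - C * t\<^sup>2 * h s) (at s)"
        using dg[of s] s T by (simp add: at_within_Icc_at)
      ultimately show "\<exists>y. (g has_real_derivative y) (at s) \<and> y \<le> 0" by blast
    next
      have "continuous_on {t0..t} g" using dg by (intro DERIV_continuous_on) auto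
      then show "continuous_on {T..t} g" by (rule continuous_on_subset) (use T in auto)
    qed
    then show ?thesis by (simp add: g_def algebra_simps)
  qed
  show ?thesis
  proof (rule order_tendstoI)
    fix a :: real assume "a < 0"
    have "eventually (\<lambda>t. t \<ge> t0) at_top" by (rule eventually_ge_at_top)
    then show "eventually (\<lambda>t. a < E t / t\<^sup>2) at_top"
    proof eventually_elim
      case (elim t)
      with E0[of t] \<open>a < 0\<close> show ?case by (smt (verit) divide_nonneg_nonneg zero_le_power2)
    qed
  next
    fix e :: real assume "0 < e"
    \<comment> \<open>Chosen so that \<open>C * \<delta> \<le> e / 2\<close>; the added 1 keeps the
      denominator positive when \<open>C = 0\<close>.\<close>
    define \<delta> where "\<delta> = e / (2 * (C + 1))"
    have "\<delta> > 0" using \<open>0 < e\<close> \<open>C \<ge> 0\<close> by (simp add: \<delta>_def)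
    have bdd: "bdd_above (F ` {t0..})" by (rule bdd_aboveI2[OF F_le])
    \<comment> \<open>With \<open>F T\<close> within \<open>\<delta>\<close> of the supremum of
      \<open>F\<close>, every later increment of \<open>F\<close> is at most
      \<open>\<delta>\<close>.\<close>
    obtain T where T: "T \<ge> t0" "(SUP t\<in>{t0..}. F t) - \<delta> < F T"
      using less_cSUP_iff[OF _ bdd, of "(SUP t\<in>{t0..}. F t) - \<delta>"] \<open>\<delta> > 0\<close> by auto
    have F_small: "F t - F T \<le> \<delta>" if "t \<ge> T" for t
      using cSUP_upper[OF _ bdd, of t] that T by auto
    have "((\<lambda>t::real. E T / t\<^sup>2) \<longlongrightarrow> 0) at_top"
      by (intro tendsto_divide_0[OF tendsto_const] filterlim_at_top_imp_at_infinity
          filterlim_pow_at_top filterlim_ident) simp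
    then have "eventually (\<lambda>t. E T / t\<^sup>2 < e / 2) at_top"
      using \<open>0 < e\<close> by (intro order_tendstoD) auto
    then show "eventually (\<lambda>t. E t / t\<^sup>2 < e) at_top"
      using eventually_ge_at_top[of T]
    proof eventually_elim
      case (elim t)
      then have "t > 0" using T \<open>t0 > 0\<close> by linarith
      have "E t \<le> E T + C * t\<^sup>2 * \<delta>"
        using growth[OF T(1) elim(2)] F_small[OF elim(2)] \<open>C \<ge> 0\<close>
        by (smt (verit) mult_left_mono mult_nonneg_nonneg zero_le_power2)
      then have "E t / t\<^sup>2 \<le> (E T + C * t\<^sup>2 * \<delta>) / t\<^sup>2"
        by (rule divide_right_mono) simp
      also have "\<dots> = E T / t\<^sup>2 + C * \<delta>"
        using \<open>t > 0\<close> by (simp add: field_simps)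
      also have "C * \<delta> \<le> e / 2"
        using \<open>C \<ge> 0\<close> \<open>0 < e\<close> by (simp add: \<delta>_def field_simps)
      finally show ?case using elim(1) by linarith
    qed
  qed
qed

text \<open>Only difference quotients from the right are used, so the endpoint \<open>t = a\<close>
  is covered as well.\<close>

lemma antimono_on_imp_right_deriv_nonpos:
  fixes g :: "real \<Rightarrow> real"
  assumes "antimono_on {a..} g" and "t \<ge> a"
    and g': "(g has_real_derivative g') (at t within {a..})"
  shows "g' \<le> 0"
proof -
  have "((\<lambda>s. (g s - g t) / (s - t)) \<longlongrightarrow> g') (at_right t)"
    using g' \<open>t \<ge> a\<close> unfolding has_field_derivative_iff
    by (elim tendsto_mono[OF at_le, rotated]) auto
  moreover have "eventually (\<lambda>s. (g s - g t) / (s - t) \<le> 0) (at_right t)"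
    using eventually_at_right_less[of t]
  proof eventually_elim
    case (elim s)
    then have "g s \<le> g t"
      using assms by (auto simp: monotone_on_def)
    with elim show ?case by (simp add: divide_nonpos_pos)
  qed
  ultimately show ?thesis
    by (rule tendsto_upperbound) simp
qed

section \<open>The pointwise energy inequality and optimality at a saddle point\<close>

text \<open>Every inner product occurring in the derivative of the energy is a separate variable; the
  first letter names the left factor, with \<open>u = x - xs\<close>, \<open>p = x'\<close>, \<open>G = gradf x\<close>, \<open>r = A x - b\<close>,
  \<open>q = A x'\<close>, \<open>l = lam\<close>, \<open>s = ls\<close> (and \<open>ss\<close> is the squared norm of \<open>xs\<close>).\<close>

lemma energy_rate_le:
  fixes t \<theta> \<sigma> \<beta> \<beta>' \<gamma> \<gamma>' \<epsilon> \<epsilon>' :: real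
  assumes t: "t > 0" "\<theta> > 0" "\<sigma> \<ge> 0" "\<beta> \<ge> 0" "\<epsilon> \<ge> 0" "\<epsilon>' \<le> 0"
    and c1: "(2 * \<theta> - 1) * \<beta> + \<theta> * t * \<beta>' \<le> 0"
    and c2: "\<gamma> + t * \<gamma>' \<le> t * \<beta> * \<epsilon>"
    and c3: "\<theta> * t * \<gamma> - \<theta> - 1 \<ge> 0"
    and nn: "xx \<ge> 0" "uu \<ge> 0" "pp \<ge> 0" "rr \<ge> 0"
    and conv: "uG \<ge> df"
    and P: "P = df + rs + \<sigma> / 2 * rr" "P \<ge> 0"
    and ux: "2 * ux = xx + uu - ss"
    and vx'': "vx'' = - \<gamma> * (up / \<theta> + t * pp) - \<beta> * ((uG / \<theta> + t * pG) + (rl / \<theta> + t * ql)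
      + \<sigma> * (rr / \<theta> + t * rq) + \<epsilon> * (ux / \<theta> + t * px))"
  shows "(2 * t * \<beta> + t\<^sup>2 * \<beta>') * (P + \<epsilon> / 2 * xx)
      + t\<^sup>2 * \<beta> * (pG + qs + \<sigma> * rq + \<epsilon>' / 2 * xx + \<epsilon> * px)
      + ((1 / \<theta> + 1) * (up / \<theta> + t * pp) + t * vx'')
      + ((\<gamma> + t * \<gamma>') / (2 * \<theta>) * uu + (\<theta> * t * \<gamma> - \<theta> - 1) / \<theta>\<^sup>2 * up)
      + t * \<beta> * (rl - rs + \<theta> * t * (ql - qs)) / \<theta>
    \<le> t * \<beta> * \<epsilon> / (2 * \<theta>) * ss" (is "?R \<le> _")
proof -
  have ss: "ss = xx + uu - 2 * ux" using ux by simp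
  \<comment> \<open>Every product with the velocity except \<open>pp\<close> cancels, and so do
    those with \<open>lam\<close>. What remains beside the \<open>ss\<close> term has a sign: the
    convexity defect, the penalty, the slacks of \<open>c1\<close>, \<open>c2\<close>,
    \<open>c3\<close>, and the term with \<open>\<epsilon>'\<close>.\<close>
  have "?R = t * \<beta> * \<epsilon> / (2 * \<theta>) * ss
      - (t * \<beta> / \<theta>) * (uG - df) - t * \<beta> * \<sigma> / (2 * \<theta>) * rr
      - (t / \<theta>) * (\<theta> * t * \<gamma> - \<theta> - 1) * pp
      - (t * \<beta> * \<epsilon> - (\<gamma> + t * \<gamma>')) / (2 * \<theta>) * uu
      + (t / \<theta>) * ((2 * \<theta> - 1) * \<beta> + \<theta> * t * \<beta>') * (P + \<epsilon> / 2 * xx)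
      + t\<^sup>2 * \<beta> * \<epsilon>' / 2 * xx"
    using \<open>\<theta> > 0\<close> unfolding P(1) vx'' ss by (simp add: field_simps power2_eq_square)
  moreover have "(t * \<beta> / \<theta>) * (uG - df) \<ge> 0" "t * \<beta> * \<sigma> / (2 * \<theta>) * rr \<ge> 0"
    "(t / \<theta>) * (\<theta> * t * \<gamma> - \<theta> - 1) * pp \<ge> 0"
    "(t * \<beta> * \<epsilon> - (\<gamma> + t * \<gamma>')) / (2 * \<theta>) * uu \<ge> 0"
    using t c2 c3 nn conv by simp_all
  moreover have "(t / \<theta>) * ((2 * \<theta> - 1) * \<beta> + \<theta> * t * \<beta>') * (P + \<epsilon> / 2 * xx) \<le> 0"
    using t c1 nn P(2) by (intro mult_nonpos_nonneg mult_nonneg_nonpos) auto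
  moreover have "t\<^sup>2 * \<beta> * \<epsilon>' / 2 * xx \<le> 0"
    using t nn by (intro mult_nonpos_nonneg) (auto simp: mult_nonneg_nonpos)
  ultimately show ?thesis by linarith
qed

text \<open>Maximality in the multiplier forces feasibility; minimality in the primal variable gives
  the stationarity condition.\<close>

lemma saddle_pointsD:
  fixes A :: "'a::real_inner \<Rightarrow> 'b::real_inner"
  assumes A: "bounded_linear A" and G: "GDERIV f xs :> G"
    and saddle: "(xs, ls) \<in> saddle_points f A b \<sigma>"
  shows "A xs = b" and "h \<bullet> G + ls \<bullet> A h = 0"
    and "aug_lagrangian f A b \<sigma> xs ls \<le> aug_lagrangian f A b \<sigma> x ls"
proof -
  \<comment> \<open>Shifting the multiplier by the residual raises the Lagrangian by the squared
    norm of the residual, which must therefore vanish.\<close>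
  have "aug_lagrangian f A b \<sigma> xs (ls + (A xs - b)) \<le> aug_lagrangian f A b \<sigma> xs ls"
    and min: "aug_lagrangian f A b \<sigma> xs ls \<le> aug_lagrangian f A b \<sigma> y ls" for y
    using saddle unfolding saddle_points_def by blast+
  then have "(A xs - b) \<bullet> (A xs - b) \<le> 0"
    by (simp add: aug_lagrangian_def inner_add_left)
  then show Axs: "A xs = b"
    by (metis eq_iff_diff_eq_0 inner_eq_zero_iff inner_ge_zero order_antisym)
  \<comment> \<open>The penalty contributes nothing to the derivative at \<open>xs\<close>, since it
    is quadratic in a residual that vanishes there.\<close>
  have "((\<lambda>y. aug_lagrangian f A b \<sigma> y ls) has_derivative (\<lambda>h. h \<bullet> G + ls \<bullet> A h)) (at xs)"
    using G unfolding aug_lagrangian_def power2_norm_eq_inner gderiv_def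
    by (auto intro!: derivative_eq_intros bounded_linear.has_derivative[OF A] simp: Axs)
  then have "(\<lambda>h. h \<bullet> G + ls \<bullet> A h) = (\<lambda>h. 0)"
    using differential_zero_maxmin[of xs UNIV] min by blast
  then show "h \<bullet> G + ls \<bullet> A h = 0" by metis
  show "aug_lagrangian f A b \<sigma> xs ls \<le> aug_lagrangian f A b \<sigma> x ls" by (rule min)
qed

theorem theorem2p2:
  fixes f :: "'a::{real_inner, complete_space} \<Rightarrow> real"
    and gradf :: "'a \<Rightarrow> 'a"
    and A :: "'a \<Rightarrow> 'b::{real_inner, complete_space}"
    and b :: 'b
    and \<theta> t0 \<sigma> :: real
    and \<gamma> \<gamma>' \<beta> \<beta>' \<epsilon> \<epsilon>' :: "real \<Rightarrow> real"
    and x x' x'' :: "real \<Rightarrow> 'a"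
    and lam lam' :: "real \<Rightarrow> 'b"
    and xs :: 'a and ls :: 'b
  assumes gradient: "\<And>z. GDERIV f z :> gradf z"
    and C1_f: "continuous_on UNIV gradf"
    and Lipschitz_gradient: "\<exists>L. L-lipschitz_on UNIV gradf"
    and convex_f: "convex_on UNIV f"
    and A: "bounded_linear A"
    and "\<theta> > 0" and "t0 > 0" and "\<sigma> \<ge> 0"
    and C1_\<gamma>: "C1_on_with {t0..} \<gamma> \<gamma>'"
    and C1_\<beta>: "C1_on_with {t0..} \<beta> \<beta>'"
    and C1_\<epsilon>: "C1_on_with {t0..} \<epsilon> \<epsilon>'"
    and nonneg: "\<And>t. t \<ge> t0 \<Longrightarrow> \<gamma> t \<ge> 0 \<and> \<beta> t \<ge> 0 \<and> \<epsilon> t \<ge> 0"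
    and \<epsilon>_noninc: "antimono_on {t0..} \<epsilon>"
    and integrable: "(\<lambda>t. \<beta> t * \<epsilon> t / t) integrable_on {t0..}"
    and "\<And>t. t \<ge> t0 \<Longrightarrow> (2 * \<theta> - 1) * \<beta> t + \<theta> * t * \<beta>' t \<le> 0"
    and "\<And>t. t \<ge> t0 \<Longrightarrow> \<gamma> t + t * \<gamma>' t \<le> t * \<beta> t * \<epsilon> t"
    and "\<And>t. t \<ge> t0 \<Longrightarrow> \<theta> * t * \<gamma> t - \<theta> - 1 \<ge> 0"
    and trajectory: "trajectory gradf A b \<theta> t0 \<sigma> \<gamma> \<beta> \<epsilon> x x' x'' lam lam'"
    and saddle: "(xs, ls) \<in> saddle_points f A b \<sigma>"
  shows "((\<lambda>t. norm ((1 / (\<theta> * t)) *\<^sub>R (x t - xs) + x' t)) \<longlongrightarrow> 0) at_top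
    \<and> (Liminf at_top (\<lambda>t. ereal (\<beta> t)) \<noteq> 0 \<longrightarrow>
        ((\<lambda>t. aug_lagrangian f A b \<sigma> (x t) ls - aug_lagrangian f A b \<sigma> xs ls) \<longlongrightarrow> 0) at_top)
    \<and> (filterlim \<beta> at_top at_top \<longrightarrow>
        (\<lambda>t. aug_lagrangian f A b \<sigma> (x t) ls - aug_lagrangian f A b \<sigma> xs ls)
          \<in> o[at_top](\<lambda>t. 1 / \<beta> t)
        \<and> (\<lambda>t. norm (gradf (x t) - gradf xs)) \<in> o[at_top](\<lambda>t. 1 / sqrt (\<beta> t)))"
proof -

  \<comment> \<open>Saddle point data and the differential equations\<close>
  interpret A: bounded_linear A by (rule A)
  define gap where "gap y = aug_lagrangian f A b \<sigma> y ls - aug_lagrangian f A b \<sigma> xs ls" for y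
  note Axs = saddle_pointsD(1)[OF A gradient saddle]
  note stationary = saddle_pointsD(2)[OF A gradient saddle]
  have gap_nonneg: "gap y \<ge> 0" for y
    using saddle_pointsD(3)[OF A gradient saddle] by (simp add: gap_def)
  have gap_eq: "gap y = f y - f xs + ls \<bullet> (A y - b) + \<sigma> / 2 * ((A y - b) \<bullet> (A y - b))" for y
    by (simp add: gap_def aug_lagrangian_def Axs power2_norm_eq_inner)
  note adj = adjoint_works_Hilbert[OF A]
  have dx: "(x has_vector_derivative x' t) (at t within {t0..})"
    and dx': "(x' has_vector_derivative x'' t) (at t within {t0..})"
    and dlam: "(lam has_vector_derivative lam' t) (at t within {t0..})" if "t \<ge> t0" for t
    using trajectory that unfolding trajectory_def by blast+
  have ode1: "x'' t = - (\<gamma> t *\<^sub>R x' t) - \<beta> t *\<^sub>R (gradf (x t) + adjoint A (lam t)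
                  + \<sigma> *\<^sub>R adjoint A (A (x t) - b) + \<epsilon> t *\<^sub>R x t)"
    and ode2: "lam' t = (t * \<beta> t) *\<^sub>R (A (x t + (\<theta> * t) *\<^sub>R x' t) - b)" if "t \<ge> t0" for t
  proof -
    have *: "p = - q - r" if "p + q + r = 0" for p q r :: 'a
      using that by (simp add: eq_neg_iff_add_eq_0 algebra_simps)
    show "x'' t = - (\<gamma> t *\<^sub>R x' t) - \<beta> t *\<^sub>R (gradf (x t) + adjoint A (lam t)
        + \<sigma> *\<^sub>R adjoint A (A (x t) - b) + \<epsilon> t *\<^sub>R x t)"
      by (rule *) (use trajectory that in \<open>unfold trajectory_def, blast\<close>)
    show "lam' t = (t * \<beta> t) *\<^sub>R (A (x t + (\<theta> * t) *\<^sub>R x' t) - b)"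
      using trajectory that unfolding trajectory_def by (metis eq_iff_diff_eq_0)
  qed
  have d\<beta>: "(\<beta> has_real_derivative \<beta>' t) (at t within {t0..})"
    and d\<gamma>: "(\<gamma> has_real_derivative \<gamma>' t) (at t within {t0..})"
    and d\<epsilon>: "(\<epsilon> has_real_derivative \<epsilon>' t) (at t within {t0..})" if "t \<ge> t0" for t
    using C1_\<gamma> C1_\<beta> C1_\<epsilon> that unfolding C1_on_with_def by auto

  \<comment> \<open>The energy and its derivative along the trajectory\<close>
  define v where "v t = (1 / \<theta>) *\<^sub>R (x t - xs) + t *\<^sub>R x' t" for t
  define W where "W t = gap (x t) + \<epsilon> t / 2 * (x t \<bullet> x t)" for t
  \<comment> \<open>The weight of \<open>(x t - xs) \<bullet> (x t - xs)\<close> makes the terms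
    \<open>(x t - xs) \<bullet> x' t\<close> cancel in the derivative; the weight
    \<open>1 / (2 * \<theta>)\<close> makes the coupling with \<open>lam t\<close> cancel.\<close>
  define E where "E t = t\<^sup>2 * \<beta> t * W t + v t \<bullet> v t / 2
    + (\<theta> * t * \<gamma> t - \<theta> - 1) / (2 * \<theta>\<^sup>2) * ((x t - xs) \<bullet> (x t - xs))
    + (lam t - ls) \<bullet> (lam t - ls) / (2 * \<theta>)" for t
  \<comment> \<open>\<open>x''\<close> and \<open>lam'\<close> stay in place here; the differential
    equations enter only in \<open>E'_le\<close>.\<close>
  define E' where "E' t = (2 * t * \<beta> t + t\<^sup>2 * \<beta>' t) * W t
      + t\<^sup>2 * \<beta> t * (x' t \<bullet> gradf (x t) + A (x' t) \<bullet> ls + \<sigma> * ((A (x t) - b) \<bullet> A (x' t))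
        + \<epsilon>' t / 2 * (x t \<bullet> x t) + \<epsilon> t * (x t \<bullet> x' t))
      + ((1 / \<theta> + 1) * (v t \<bullet> x' t) + t * (v t \<bullet> x'' t))
      + ((\<gamma> t + t * \<gamma>' t) / (2 * \<theta>) * ((x t - xs) \<bullet> (x t - xs))
         + (\<theta> * t * \<gamma> t - \<theta> - 1) / \<theta>\<^sup>2 * ((x t - xs) \<bullet> x' t))
      + (lam t - ls) \<bullet> lam' t / \<theta>" for t
  have dE: "(E has_real_derivative E' t) (at t within {t0..})" if t: "t \<ge> t0" for t
  proof -
    have du: "((\<lambda>t. x t - xs) has_vector_derivative x' t) (at t within {t0..})"
      using dx[OF t] by (auto intro!: derivative_eq_intros)
    have dr: "((\<lambda>t. A (x t) - b) has_vector_derivative A (x' t)) (at t within {t0..})"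
      using A.has_vector_derivative[OF dx[OF t]] by (auto intro!: derivative_eq_intros)
    have dl: "((\<lambda>t. lam t - ls) has_vector_derivative lam' t) (at t within {t0..})"
      using dlam[OF t] by (auto intro!: derivative_eq_intros)
    have dv: "(v has_vector_derivative ((1 / \<theta> + 1) *\<^sub>R x' t + t *\<^sub>R x'' t)) (at t within {t0..})"
      unfolding v_def using dx[OF t] dx'[OF t]
      by (auto intro!: derivative_eq_intros simp: algebra_simps)
    have dvv: "((\<lambda>t. v t \<bullet> v t) has_real_derivative
        2 * ((1 / \<theta> + 1) * (v t \<bullet> x' t) + t * (v t \<bullet> x'' t))) (at t within {t0..})"
      using has_real_derivative_inner[OF dv dv]
      by (simp only: inner_add_right inner_scaleR_right inner_commute[of _ "v t"] mult_2)
    have dW: "(W has_real_derivative (x' t \<bullet> gradf (x t) + A (x' t) \<bullet> ls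
        + \<sigma> * ((A (x t) - b) \<bullet> A (x' t)) + \<epsilon>' t / 2 * (x t \<bullet> x t) + \<epsilon> t * (x t \<bullet> x' t)))
        (at t within {t0..})"
      unfolding W_def gap_eq
      by (rule derivative_eq_intros d\<epsilon>[OF t] numeral_neq_zero refl
          GDERIV_compose_has_vector_derivative[where f = f, OF gradient dx[OF t]]
          has_real_derivative_inner[OF has_vector_derivative_const dr]
          has_real_derivative_inner[OF dr dr] has_real_derivative_inner[OF dx[OF t] dx[OF t]])+
        (simp add: inner_commute field_simps)
    have nz: "2 * \<theta> \<noteq> 0" "2 * \<theta>\<^sup>2 \<noteq> 0" using \<open>\<theta> > 0\<close> by simp_all
    show ?thesis
      unfolding E_def
      by (rule derivative_eq_intros d\<beta>[OF t] d\<gamma>[OF t] dW has_real_derivative_inner[OF du du]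
          dvv has_real_derivative_inner[OF dl dl] nz numeral_neq_zero refl)+
        (use \<open>\<theta> > 0\<close> in \<open>simp_all add: E'_def inner_commute field_simps power2_eq_square\<close>)
  qed
  \<comment> \<open>The bound \<open>t * \<beta> t * \<epsilon> t\<close>, up to a constant, is
    written as \<open>t\<^sup>2\<close> times the integrable function, the form required by the
    growth lemma.\<close>
  have E'_le: "E' t \<le> xs \<bullet> xs / (2 * \<theta>) * t\<^sup>2 * (\<beta> t * \<epsilon> t / t)" if t: "t \<ge> t0" for t
  proof -
    have "t > 0" using t \<open>t0 > 0\<close> by simp
    have v_inner: "v t \<bullet> y = ((x t - xs) \<bullet> y) / \<theta> + t * (x' t \<bullet> y)" for y
      by (simp add: v_def inner_add_left)
    \<comment> \<open>Feasibility of \<open>xs\<close> turns \<open>A (x t - xs)\<close> into the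
      residual \<open>A (x t) - b\<close>.\<close>
    have v_adj: "v t \<bullet> adjoint A y = ((A (x t) - b) \<bullet> y) / \<theta> + t * (A (x' t) \<bullet> y)" for y
      by (simp add: adj v_def A.add A.diff A.scaleR Axs inner_add_left)
    have vx'': "v t \<bullet> x'' t = - \<gamma> t * ((x t - xs) \<bullet> x' t / \<theta> + t * (x' t \<bullet> x' t))
      - \<beta> t * (((x t - xs) \<bullet> gradf (x t) / \<theta> + t * (x' t \<bullet> gradf (x t)))
        + ((A (x t) - b) \<bullet> lam t / \<theta> + t * (A (x' t) \<bullet> lam t))
        + \<sigma> * ((A (x t) - b) \<bullet> (A (x t) - b) / \<theta> + t * ((A (x t) - b) \<bullet> A (x' t)))
        + \<epsilon> t * ((x t - xs) \<bullet> x t / \<theta> + t * (x t \<bullet> x' t)))"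
      unfolding ode1[OF t] inner_diff_right inner_add_right inner_minus_right inner_scaleR_right v_adj
      unfolding v_inner
      by (simp add: inner_diff_left inner_diff_right inner_commute)
    have lam': "(lam t - ls) \<bullet> lam' t = t * \<beta> t * ((A (x t) - b) \<bullet> lam t - (A (x t) - b) \<bullet> ls
        + \<theta> * t * (A (x' t) \<bullet> lam t - A (x' t) \<bullet> ls))"
      by (simp add: ode2[OF t] A.add A.scaleR inner_commute algebra_simps)
    have tangent: "(x t - xs) \<bullet> gradf (x t) \<ge> f (x t) - f xs"
      using convex_on_above_tangent_GDERIV[OF convex_f gradient, of "x t" xs]
      by (simp add: inner_diff_left)
    have "E' t \<le> t * \<beta> t * \<epsilon> t / (2 * \<theta>) * (xs \<bullet> xs)"
      unfolding E'_def lam' W_def v_inner[of "x' t"]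
    proof (rule energy_rate_le[OF \<open>t > 0\<close> \<open>\<theta> > 0\<close> \<open>\<sigma> \<ge> 0\<close> _ _ _ assms(15)[OF t] assms(16)[OF t]
        assms(17)[OF t] _ _ _ _ tangent _ gap_nonneg _ vx''])
      show "\<epsilon>' t \<le> 0"
        using antimono_on_imp_right_deriv_nonpos[OF \<epsilon>_noninc t d\<epsilon>[OF t]] .
      show "gap (x t) = f (x t) - f xs + (A (x t) - b) \<bullet> ls
          + \<sigma> / 2 * ((A (x t) - b) \<bullet> (A (x t) - b))"
        by (simp add: gap_eq inner_commute)
      show "2 * ((x t - xs) \<bullet> x t) = x t \<bullet> x t + (x t - xs) \<bullet> (x t - xs) - xs \<bullet> xs"
        by (simp add: inner_diff_left inner_diff_right inner_commute)
    qed (use nonneg[OF t] in auto)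
    also have "\<dots> = xs \<bullet> xs / (2 * \<theta>) * t\<^sup>2 * (\<beta> t * \<epsilon> t / t)"
      using \<open>t > 0\<close> by (simp add: power2_eq_square)
    finally show ?thesis .
  qed

  \<comment> \<open>Nonnegativity of the energy terms and decay of
    \<open>E t / t\<^sup>2\<close>\<close>
  have W_nonneg: "W t \<ge> 0" if "t \<ge> t0" for t
    using nonneg[OF that] gap_nonneg by (simp add: W_def)
  have rest_nonneg: "(\<theta> * t * \<gamma> t - \<theta> - 1) / (2 * \<theta>\<^sup>2) * ((x t - xs) \<bullet> (x t - xs)) \<ge> 0"
    "(lam t - ls) \<bullet> (lam t - ls) / (2 * \<theta>) \<ge> 0" "t\<^sup>2 * \<beta> t * W t \<ge> 0" "v t \<bullet> v t / 2 \<ge> 0"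
    if "t \<ge> t0" for t
    using assms(17)[OF that] \<open>\<theta> > 0\<close> nonneg[OF that] W_nonneg[OF that] by simp_all
  have E_lim: "((\<lambda>t. E t / t\<^sup>2) \<longlongrightarrow> 0) at_top"
  proof (rule tendsto_div_square_of_deriv_le[OF \<open>t0 > 0\<close> _ dE E'_le])
    show "E t \<ge> 0" if "t \<ge> t0" for t
      using rest_nonneg[OF that] by (simp add: E_def)
    show "\<beta> t * \<epsilon> t / t \<ge> 0" if "t \<ge> t0" for t
      using nonneg[OF that] that \<open>t0 > 0\<close> by simp
    have "continuous_on {t0..} \<beta>" "continuous_on {t0..} \<epsilon>"
      using d\<beta> d\<epsilon> by (auto intro: DERIV_continuous_on)
    then show "continuous_on {t0..} (\<lambda>t. \<beta> t * \<epsilon> t / t)"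
      using \<open>t0 > 0\<close> by (intro continuous_intros) auto
  qed (use \<open>\<theta> > 0\<close> integrable in auto)
  have ev: "eventually (\<lambda>t. t \<ge> t0) at_top" by (rule eventually_ge_at_top)

  \<comment> \<open>Claim (a): decay of the velocity combination\<close>
  have a: "((\<lambda>t. norm ((1 / (\<theta> * t)) *\<^sub>R (x t - xs) + x' t)) \<longlongrightarrow> 0) at_top"
  proof -
    have "((\<lambda>t. sqrt (2 * (E t / t\<^sup>2))) \<longlongrightarrow> 0) at_top"
      using tendsto_real_sqrt[OF tendsto_mult_right_zero[OF E_lim, of 2]] by simp
    moreover have "eventually (\<lambda>t. norm (norm ((1 / (\<theta> * t)) *\<^sub>R (x t - xs) + x' t))
        \<le> sqrt (2 * (E t / t\<^sup>2))) at_top"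
      using ev
    proof eventually_elim
      case (elim t)
      then have "t > 0" using \<open>t0 > 0\<close> by simp
      \<comment> \<open>The vector in the claim is \<open>v t\<close> divided by \<open>t\<close>,
        so its squared norm is at most \<open>2 * E t / t\<^sup>2\<close>.\<close>
      then have "(1 / (\<theta> * t)) *\<^sub>R (x t - xs) + x' t = (1 / t) *\<^sub>R v t"
        by (simp add: v_def scaleR_add_right)
      then have "(norm ((1 / (\<theta> * t)) *\<^sub>R (x t - xs) + x' t))\<^sup>2 = (v t \<bullet> v t) / t\<^sup>2"
        by (simp add: power_mult_distrib power2_norm_eq_inner power_divide)
      also have "v t \<bullet> v t \<le> 2 * E t"
        using rest_nonneg[OF elim] unfolding E_def by argo
      finally show ?case by (simp add: real_le_rsqrt divide_right_mono)
    qed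
    ultimately show ?thesis by (rule Lim_null_comparison[rotated])
  qed

  \<comment> \<open>Claim (b): decay of the Lagrangian gap and of the gradient difference\<close>
  have \<beta>_gap: "((\<lambda>t. \<beta> t * gap (x t)) \<longlongrightarrow> 0) at_top"
  proof (rule Lim_null_comparison[OF _ E_lim])
    show "eventually (\<lambda>t. norm (\<beta> t * gap (x t)) \<le> E t / t\<^sup>2) at_top"
      using ev
    proof eventually_elim
      case (elim t)
      have "t > 0" using elim \<open>t0 > 0\<close> by simp
      have "gap (x t) \<le> W t" using nonneg[OF elim] by (simp add: W_def)
      then have "\<beta> t * gap (x t) \<le> (t\<^sup>2 * \<beta> t * W t) / t\<^sup>2"
        using nonneg[OF elim] \<open>t > 0\<close> by (simp add: mult_left_mono)
      also have "\<dots> \<le> E t / t\<^sup>2"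
        using rest_nonneg[OF elim] unfolding E_def by (intro divide_right_mono) auto
      finally show ?case using nonneg[OF elim] gap_nonneg by simp
    qed
  qed

  have b1: "((\<lambda>t. gap (x t)) \<longlongrightarrow> 0) at_top" if L: "Liminf at_top (\<lambda>t. ereal (\<beta> t)) \<noteq> 0"
  proof -
    have "Liminf at_top (\<lambda>t. ereal (\<beta> t)) \<ge> 0"
      by (rule Liminf_bounded) (use nonneg in \<open>auto intro: eventually_mono[OF ev]\<close>)
    with L have "Liminf at_top (\<lambda>t. ereal (\<beta> t)) > 0" by simp
    \<comment> \<open>A real \<open>c\<close> strictly between 0 and the limit inferior bounds
      \<open>\<beta>\<close> below eventually; an infinite limit inferior is included.\<close>
    then obtain c where c: "0 < ereal c" "ereal c < Liminf at_top (\<lambda>t. ereal (\<beta> t))"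
      using ereal_dense2 by blast
    have "((\<lambda>t. \<beta> t * gap (x t) / c) \<longlongrightarrow> 0) at_top"
      using tendsto_divide_zero[OF \<beta>_gap] .
    moreover have "eventually (\<lambda>t. norm (gap (x t)) \<le> \<beta> t * gap (x t) / c) at_top"
      using less_LiminfD[OF c(2)]
    proof eventually_elim
      case (elim t)
      then have "c * gap (x t) \<le> \<beta> t * gap (x t)"
        using gap_nonneg by (intro mult_right_mono) auto
      then show ?case using c gap_nonneg by (simp add: field_simps)
    qed
    ultimately show ?thesis by (rule Lim_null_comparison[rotated])
  qed

  have b2: "(\<lambda>t. gap (x t)) \<in> o[at_top](\<lambda>t. 1 / \<beta> t)
      \<and> (\<lambda>t. norm (gradf (x t) - gradf xs)) \<in> o[at_top](\<lambda>t. 1 / sqrt (\<beta> t))"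
    if \<beta>: "filterlim \<beta> at_top at_top"
  proof
    have pos: "eventually (\<lambda>t. \<beta> t > 0) at_top"
      using \<beta> by (simp add: filterlim_at_top_dense)
    show "(\<lambda>t. gap (x t)) \<in> o[at_top](\<lambda>t. 1 / \<beta> t)"
    proof (rule smalloI_tendsto)
      show "((\<lambda>t. gap (x t) / (1 / \<beta> t)) \<longlongrightarrow> 0) at_top"
        using \<beta>_gap by (simp add: mult.commute)
    qed (use pos in \<open>auto elim: eventually_mono\<close>)
    obtain L where "L-lipschitz_on UNIV gradf" using Lipschitz_gradient by blast
    \<comment> \<open>The constant is raised to at least 1 because the gradient bound divides by it
      and a Lipschitz constant may be 0.\<close>
    then have L: "(max L 1)-lipschitz_on UNIV gradf" by (rule lipschitz_on_le) simp
    have grad: "(norm (gradf y - gradf xs))\<^sup>2 \<le> 2 * max L 1 * gap y" for y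
    proof -
      have "(norm (gradf y - gradf xs))\<^sup>2 \<le> 2 * max L 1 * (f y - f xs - (y - xs) \<bullet> gradf xs)"
        by (rule convex_Lipschitz_gradient_bound[OF convex_f gradient L]) simp
      \<comment> \<open>Stationarity exchanges the linear term for the multiplier term, giving the
        gap without its penalty, which is nonnegative.\<close>
      also have "f y - f xs - (y - xs) \<bullet> gradf xs = f y - f xs + ls \<bullet> (A y - b)"
        using stationary[of "y - xs"] by (simp add: A.diff Axs)
      also have "2 * max L 1 * \<dots> \<le> 2 * max L 1 * gap y"
        using \<open>\<sigma> \<ge> 0\<close> by (intro mult_left_mono) (auto simp: gap_eq)
      finally show ?thesis .
    qed
    show "(\<lambda>t. norm (gradf (x t) - gradf xs)) \<in> o[at_top](\<lambda>t. 1 / sqrt (\<beta> t))"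
    proof (rule smalloI_tendsto)
      \<comment> \<open>Multiplying the squared gradient bound by \<open>\<beta> t\<close> reduces
        the rate to the limit \<open>\<beta>_gap\<close>.\<close>
      have "((\<lambda>t. sqrt (2 * max L 1 * (\<beta> t * gap (x t)))) \<longlongrightarrow> 0) at_top"
        using tendsto_real_sqrt[OF tendsto_mult_right_zero[OF \<beta>_gap, of "2 * max L 1"]] by simp
      moreover have "eventually (\<lambda>t. norm (norm (gradf (x t) - gradf xs) / (1 / sqrt (\<beta> t)))
          \<le> sqrt (2 * max L 1 * (\<beta> t * gap (x t)))) at_top"
        using pos
      proof eventually_elim
        case (elim t)
        have "(norm (gradf (x t) - gradf xs) * sqrt (\<beta> t))\<^sup>2
            = (norm (gradf (x t) - gradf xs))\<^sup>2 * \<beta> t"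
          using elim by (simp add: power_mult_distrib)
        also have "\<dots> \<le> 2 * max L 1 * gap (x t) * \<beta> t"
          using grad elim by (intro mult_right_mono) auto
        also have "\<dots> = 2 * max L 1 * (\<beta> t * gap (x t))" by (simp only: mult_ac)
        finally show ?case using elim by (simp add: real_le_rsqrt)
      qed
      ultimately show "((\<lambda>t. norm (gradf (x t) - gradf xs) / (1 / sqrt (\<beta> t))) \<longlongrightarrow> 0) at_top"
        by (rule Lim_null_comparison[rotated])
    qed (use pos in \<open>auto elim: eventually_mono\<close>)
  qed
  show ?thesis using a b1 b2 unfolding gap_def by blast
qed

end
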